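(* Let $n\ge 3$ be an integer, let $q=3^n$ and let $a\in\mathbb{F}_q$. Then the ternary Kloosterman sum $\mathcal{K}_q(a)$ satisfies \[ \mathcal{K}_q(a)\equiv\begin{cases} 0\pmod{27} & \text{if } \operatorname{Tr}(a)=0 \text{ and } \tau_Y(a)+2\tau_X(a)=0,\\ 3\pmod{27} & \text{if } \operatorname{Tr}(a)=1 \text{ and } \tau_Y(a)=2,\\ 6\pmod{27} & \text{if } \operatorname{Tr}(a)=2 \text{ and } \tau_Y(a)+\tau_X(a)=2,\\ 9\pmod{27} & \text{if } \operatorname{Tr}(a)=0 \text{ and } \tau_Y(a)+2\tau_X(a)=1,\\ 12\pmod{27} & \text{if } \operatorname{Tr}(a)=1 \text{ and } \tau_Y(a)=0,\\ 15\pmod{27} & \text{if } \operatorname{Tr}(a)=2 \text{ and } \tau_Y(a)+\tau_X(a)=0,\\ 18\pmod{27} & \text{if } \operatorname{Tr}(a)=0 \text{ and } \tau_Y(a)+2\tau_X(a)=2,\\ 21\pmod{27} & \text{if } \operatorname{Tr}(a)=1 \text{ and } \tau_Y(a)=1,\\ 24\pmod{27} & \text{if } \operatorname{Tr}(a)=2 \text{ and } \tau_Y(a)+\tau_X(a)=1, \end{cases} \] where the conditions on $\operatorname{Tr}(a),\tau_X(a),\tau_Y(a)$ are equalities in $\mathbb{F}_3$.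
   Context: For $q=3^n$, $\operatorname{Tr}:\mathbb{F}_q\to\mathbb{F}_3$ is the absolute trace $\operatorname{Tr}(c)=c+c^3+c^{3^2}+\cdots+c^{3^{n-1}}$. With $\zeta$ a primitive cube root of unity, the ternary Kloosterman sum is \[\mathcal{K}_q(a)=\sum_{x\in\mathbb{F}_q}\zeta^{\operatorname{Tr}(x^{q-2}+ax)},\] where the sum includes $x=0$ (so $x^{q-2}=x^{-1}$ for $x\neq0$ and $0^{q-2}=0$). It is a rational integer, independent of the choice of $\zeta$. Define the sets of exponents (indices $i,j,k$ are nonnegative integers) \[X=\{r\in\{0,\dots,q-2\}: r=3^i+3^j,\ i,j\text{ not necessarily distinct}\},\] \[Y=\{r\in\{0,\dots,q-2\}: r=3^i+3^j+3^k,\ i,j,k\text{ distinct}\}.\] For $S\in\{X,Y\}$ put $\tau_S(a)=\sum_{s\in S}a^s$ (each element of the set $S$ counted once); this is an element of $\mathbb{F}_3$ for all $a\in\mathbb{F}_q$. *)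

theory Defs
  imports "HOL-Analysis.Analysis" "HOL-Computational_Algebra.Primes"
          "HOL-Number_Theory.Cong"
begin

text \<open>
  The field with \<open>q = 3 ^ n\<close> elements is a type of class \<^class>\<open>finite_field\<close> and cardinality
  \<open>3 ^ n\<close>. Its prime field \<open>{0, 1, 2}\<close> plays the role of \<open>\<bbbF>\<^sub>3\<close>, so values in \<open>\<bbbF>\<^sub>3\<close> (such as
  traces) are elements of the field itself.
\<close>

definition abs_trace :: "nat \<Rightarrow> 'a::finite_field \<Rightarrow> 'a" where
  "abs_trace n c = (\<Sum>i<n. c ^ (3 ^ i))"

definition primitive_cube_root :: "complex \<Rightarrow> bool" where
  "primitive_cube_root \<zeta> \<longleftrightarrow> \<zeta> ^ 3 = 1 \<and> (\<forall>m. 0 < m \<and> m < 3 \<longrightarrow> \<zeta> ^ m \<noteq> 1)"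

text \<open>
  The power \<open>\<zeta> ^ t\<close> with \<open>t\<close> in the prime field of a field of characteristic 3 is formed with the
  representative of \<open>t\<close> in \<open>{0, 1, 2}\<close>. The value is only meaningful for \<open>t\<close> in the prime field,
  to which traces belong by \<open>abs_trace_prime_field\<close> below.
\<close>

definition prime_field_rep :: "'a::finite_field \<Rightarrow> nat" where
  "prime_field_rep t = (LEAST k. of_nat k = t)"

text \<open>Since \<open>0 ^ (q - 2) = 0\<close> for \<open>q > 2\<close>, the term for \<open>x = 0\<close> contributes 1.\<close>

definition kloosterman :: "nat \<Rightarrow> complex \<Rightarrow> 'a::finite_field \<Rightarrow> complex" where
  "kloosterman n \<zeta> a =
     (\<Sum>x\<in>UNIV. \<zeta> ^ prime_field_rep (abs_trace n (x ^ (3 ^ n - 2) + a * x)))"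

definition X_exps :: "nat \<Rightarrow> nat set" where
  "X_exps n = {r \<in> {0..3 ^ n - 2}. \<exists>i j. r = 3 ^ i + 3 ^ j}"

definition Y_exps :: "nat \<Rightarrow> nat set" where
  "Y_exps n = {r \<in> {0..3 ^ n - 2}. \<exists>i j k. i \<noteq> j \<and> i \<noteq> k \<and> j \<noteq> k \<and> r = 3 ^ i + 3 ^ j + 3 ^ k}"

definition tau :: "nat set \<Rightarrow> 'a::finite_field \<Rightarrow> 'a" where
  "tau S a = (\<Sum>s\<in>S. a ^ s)"

lemma CHAR_eq_3:
  assumes "CARD('a::finite_field) = 3 ^ n"
  shows "CHAR('a) = 3"
proof -
  have p: "prime CHAR('a)"
    using CHAR_pos prime_CHAR_semidom by blast
  have "CHAR('a) dvd 3 ^ n"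
  proof -
    have "(\<Sum>x\<in>UNIV. x + 1) = (\<Sum>x\<in>UNIV. x :: 'a)"
      by (rule sum.reindex_bij_witness[of _ "\<lambda>x. x - 1" "\<lambda>x. x + 1"]) auto
    then have "of_nat CARD('a) = (0 :: 'a)"
      by (simp add: sum.distrib)
    then show ?thesis
      using assms of_nat_eq_0_iff_char_dvd[where 'a = 'a] by metis
  qed
  then have "CHAR('a) dvd 3"
    using p prime_dvd_power by blast
  moreover have "prime (3::nat)" by simp
  ultimately show ?thesis
    using p primes_dvd_imp_eq by blast
qed

lemma abs_trace_prime_field:
  fixes c :: "'a::finite_field"
  assumes card: "CARD('a) = 3 ^ n"
  shows "abs_trace n c \<in> {0, 1, 2}"
proof -
  let ?t = "abs_trace n c"
  have char: "CHAR('a) = 3" using CHAR_eq_3[OF card] .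
  have "?t ^ 3 = (\<Sum>i<n. c ^ (3 ^ Suc i))"
    unfolding abs_trace_def
    using freshmans_dream_sum[where 'a = 'a and f = "\<lambda>i. c ^ (3 ^ i)" and A = "{..<n}"] char
    by (simp add: power_mult [symmetric] mult.commute)
  also have "\<dots> = ?t - c + c ^ (3 ^ n)"
    unfolding abs_trace_def
    using sum.lessThan_Suc_shift[of "\<lambda>i. c ^ (3 ^ i)" n] sum.lessThan_Suc[of "\<lambda>i. c ^ (3 ^ i)" n]
    by (simp add: algebra_simps)
  also have "c ^ (3 ^ n) = c"
    using finite_field_power_card_eq_same[of c] card by simp
  finally have t: "?t ^ 3 = ?t" by simp
  have three: "(3::'a) = 0"
    using of_nat_CHAR[where 'a = 'a] char by simp
  have "?t * (?t - 1) * (?t - 2) = ?t ^ 3 - ?t + 3 * (?t - ?t ^ 2)"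
    by (simp add: algebra_simps power2_eq_square power3_eq_cube)
  also have "\<dots> = 0" using t three by simp
  finally show ?thesis by auto
qed

lemma prime_field_rep:
  fixes t :: "'a::finite_field"
  assumes "CARD('a) = 3 ^ n" "t \<in> {0, 1, 2}"
  shows "prime_field_rep t < 3" "of_nat (prime_field_rep t) = t"
proof -
  obtain k :: nat where k: "k < 3" "of_nat k = t"
  proof -
    have "\<exists>k::nat. k < 3 \<and> of_nat k = t"
      using assms(2)
      by (auto intro: exI[of _ 0] exI[of _ 1] exI[of _ 2])
    then show ?thesis using that by blast
  qed
  then show "of_nat (prime_field_rep t) = t"
    unfolding prime_field_rep_def by (metis (mono_tags, lifting) LeastI)
  show "prime_field_rep t < 3"
    unfolding prime_field_rep_def using k Least_le[of "\<lambda>k. of_nat k = t" k] by linarith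
qed

end

theory Submission
  imports Defs
begin

text \<open>
  Let \<open>N\<close> be the number of \<open>x\<close> for which the trace of \<open>1/x + a x\<close> is nonzero. The substitution
  \<open>x \<mapsto> - x\<close> shows that the traces \<open>1\<close> and \<open>2\<close> occur equally often, so the Kloosterman sum is the
  integer \<open>K\<close> with \<open>2 K = 2 \<cdot> 3 ^ n - 3 N\<close>, and \<open>K\<close> modulo 27 is determined by \<open>N\<close> modulo 9.

  Counting modulo 9 takes place in the ring of Witt vectors of length two over the field, in which
  9 vanishes and which contains the integers modulo 9. Let \<open>T(y)\<close> be the sum of the Teichmueller
  lifts of the conjugates of \<open>y\<close>; it lifts the trace of \<open>y\<close>, and \<open>t = T(1/x) + T(a x)\<close> lifts the
  trace of \<open>1/x + a x\<close>. Elements above 0 have square zero and are killed by 3, and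
  therefore \<open>2 t ^ 4 - t ^ 2\<close> is exactly 1 or 0 according to whether that trace is nonzero (\<open>witt2_indicator\<close>). So \<open>N\<close> is the sum
  of these values over all \<open>x\<close>.

  Expanding the powers leads to sums of the Teichmueller lifts of \<open>x ^ m / x ^ k\<close>, which vanish
  unless \<open>m\<close> and \<open>k\<close> agree modulo \<open>3 ^ n - 1\<close> (\<open>sum_teich_orthogonality\<close>). The exponents are sums
  of at most four powers of three, so that the few coincidences can be read off from base three
  digits. The result is \<open>N = 4 T(a) + 3 T(a) ^ 2 + 3 T(a ^ 2)\<close> (\<open>nonzero_count_eq_moments\<close>).

  It remains to express \<open>T(a)\<close> modulo 9 through elements of the field. Its cube depends only on the
  trace of \<open>a\<close>, and Newton's identity for three power sums gives
  \<open>T(a) ^ 3 = 3 T(a) T(a ^ 2) - 2 T(a) + 6 E\<close>, where \<open>E\<close> is a lift of the sum \<open>\<tau>\<^sub>Y(a)\<close>. Since a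
  multiple of 3 only depends on the residue of the other factor, \<open>N\<close> modulo 9 is now a function of
  the traces of \<open>a\<close> and \<open>a ^ 2\<close> and of \<open>\<tau>\<^sub>Y(a)\<close> (\<open>nonzero_count_cong\<close>), and the trace of \<open>a ^ 2\<close> is
  \<open>2 \<tau>\<^sub>X(a)\<close> minus the square of the trace of \<open>a\<close>.
\<close>

section \<open>Witt vectors of length two for the prime three\<close>

text \<open>
  The component \<open>witt0\<close> is the residue. The operations are the universal ones: they make the ghost
  components \<open>w\<^sub>0\<close> and \<open>w\<^sub>0\<^sup>3 + 3 w\<^sub>1\<close> ring homomorphisms, so that the
  ring laws hold over every commutative ring.
\<close>
datatype 'a witt2 = Witt (witt0: 'a) (witt1: 'a)

instantiation witt2 :: (comm_ring_1) comm_ring_1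
begin

definition "0 = Witt 0 0"
definition "1 = Witt 1 0"
definition "x + y = Witt (witt0 x + witt0 y)
  (witt1 x + witt1 y - witt0 x ^ 2 * witt0 y - witt0 x * witt0 y ^ 2)"
definition "x * y = Witt (witt0 x * witt0 y)
  (witt0 x ^ 3 * witt1 y + witt0 y ^ 3 * witt1 x + 3 * witt1 x * witt1 y)"
definition "- x = Witt (- witt0 x) (- witt1 x)"
definition "x - y = x + - (y :: 'a witt2)"

instance
  by standard
    (auto simp: zero_witt2_def one_witt2_def plus_witt2_def times_witt2_def uminus_witt2_def
      minus_witt2_def algebra_simps power2_eq_square power3_eq_cube)

end

lemma witt0_simps [simp]:
  "witt0 0 = 0" "witt0 1 = 1" "witt0 (x + y) = witt0 x + witt0 y"
  "witt0 (x * y) = witt0 x * witt0 y" "witt0 (- x) = - witt0 x" "witt0 (x - y) = witt0 x - witt0 y"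
  by (simp_all add: zero_witt2_def one_witt2_def plus_witt2_def times_witt2_def uminus_witt2_def
      minus_witt2_def)

lemma witt0_of_nat [simp]: "witt0 (of_nat m) = of_nat m"
  by (induction m) auto

lemma witt0_of_int [simp]: "witt0 (of_int m) = of_int m"
  by (cases m) auto

lemma witt0_numeral [simp]: "witt0 (numeral k) = numeral k"
  using witt0_of_nat[of "numeral k"] by simp

lemma witt0_power [simp]: "witt0 (x ^ m) = witt0 x ^ m"
  by (induction m) auto

lemma witt0_sum [simp]: "witt0 (sum f A) = (\<Sum>i\<in>A. witt0 (f i))"
  by (induction A rule: infinite_finite_induct) auto

definition teich :: "'a \<Rightarrow> 'a::comm_ring_1 witt2" where
  "teich a = Witt a 0"

lemma witt0_teich [simp]: "witt0 (teich a) = a"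
  by (simp add: teich_def)

lemma teich_0 [simp]: "teich 0 = 0" and teich_1 [simp]: "teich 1 = 1"
  and teich_mult: "teich (a * b) = teich a * teich b"
  by (simp_all add: teich_def zero_witt2_def one_witt2_def times_witt2_def)

lemma teich_power: "teich (a ^ m) = teich a ^ m"
  by (induction m) (auto simp: teich_mult)

lemma three_eq_0_char_3:
  assumes "CHAR('a::comm_ring_1) = 3"
  shows "(3 :: 'a) = 0"
  using of_nat_CHAR[where 'a = 'a] assms by simp

lemma two_in_char_3:
  assumes "CHAR('a::comm_ring_1) = 3"
  shows "(2 :: 'a) = - 1" "(2 :: 'a) \<noteq> 0" "(2 :: 'a) \<noteq> 1"
proof -
  show *: "(2 :: 'a) = - 1"
    using three_eq_0_char_3[OF assms] by (simp add: eq_neg_iff_add_eq_0)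
  show "(2 :: 'a) \<noteq> 0" unfolding * by simp
  show "(2 :: 'a) \<noteq> 1"
    by (metis add_cancel_right_right one_add_one zero_neq_one)
qed

text \<open>
  In characteristic 3 one has \<open>3 = 1 + 1 + 1 = Witt 0 1\<close>, so that multiplying by 3 cubes the residue
  and moves it to the second component.
\<close>
lemma three_mult_witt2:
  fixes w :: "'a::comm_ring_1 witt2"
  assumes "CHAR('a) = 3"
  shows "3 * w = Witt 0 (witt0 w ^ 3)"
proof -
  have "(3 :: 'a witt2) = 1 + 1 + 1" by simp
  also have "\<dots> = Witt 3 (1 - 9)"
    by (simp only: one_witt2_def plus_witt2_def witt2.sel) simp
  also have "(3 :: 'a) = 0"
    by (rule three_eq_0_char_3[OF assms])
  finally have "3 = Witt 0 (1 - 3 * 3 :: 'a)" by simp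
  also have "\<dots> = Witt 0 1"
    using three_eq_0_char_3[OF assms] by simp
  finally have "3 * w = Witt 0 1 * w" by simp
  then show ?thesis
    using three_eq_0_char_3[OF assms] by (simp add: times_witt2_def)
qed


lemma three_mult_witt2_cong:
  fixes v w :: "'a::comm_ring_1 witt2"
  assumes "CHAR('a) = 3" "witt0 v = witt0 w"
  shows "3 * v = 3 * w"
  using assms by (simp add: three_mult_witt2)

lemma nine_eq_0_witt2:
  assumes "CHAR('a::comm_ring_1) = 3"
  shows "(9 :: 'a witt2) = 0"
proof -
  have "3 * (3 :: 'a witt2) = 3 * 0"
    using assms three_eq_0_char_3[OF assms] by (intro three_mult_witt2_cong) auto
  then show ?thesis by simp
qed

lemma witt0_eq_0_mult:
  fixes v w :: "'a::comm_ring_1 witt2"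
  assumes "CHAR('a) = 3" "witt0 v = 0" "witt0 w = 0"
  shows "v * w = 0"
  using assms three_eq_0_char_3[OF assms(1)] by (simp add: times_witt2_def zero_witt2_def)

text \<open>This lets congruences modulo 9 between integers be read off from equations of Witt vectors.\<close>
lemma of_int_witt2_eq_0_imp_9_dvd:
  assumes char: "CHAR('a::finite_field) = 3" and 0: "(of_int m :: 'a witt2) = 0"
  shows "9 dvd m"
proof -
  have dvd: "3 dvd k" if "(of_int k :: 'a) = 0" for k
    using that char of_int_eq_0_iff_char_dvd[where 'a = 'a] by simp
  have "(of_int m :: 'a) = witt0 (of_int m)" by simp
  then have "3 dvd m" unfolding 0 by (intro dvd) simp
  then obtain k where k: "m = 3 * k" by auto
  have "Witt 0 (witt0 (of_int k :: 'a witt2) ^ 3) = 0"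
    using 0 three_mult_witt2[OF char, of "of_int k"] by (simp add: k)
  then have "3 dvd k" by (intro dvd) (simp add: zero_witt2_def)
  then show ?thesis by (auto simp: k)
qed

lemma witt2_mult_eq_0_cancel:
  fixes v w :: "'a::field witt2"
  assumes char: "CHAR('a) = 3" and v: "witt0 v \<noteq> 0" and 0: "v * w = 0"
  shows "w = 0"
  using 0 v three_eq_0_char_3[OF char] by (cases w) (auto simp: times_witt2_def zero_witt2_def)

text \<open>
  Polynomials in \<open>t\<close> are evaluated by a first-order Taylor expansion at an integer with the same
  residue, because the difference \<open>d\<close> has square zero.
\<close>
lemma witt2_prime_field_decomp:
  fixes t :: "'a::comm_ring_1 witt2"
  assumes char: "CHAR('a) = 3" and t: "witt0 t = of_int s"
  obtains d where "t = of_int s + d" "d * d = 0" "3 * d = 0"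
proof (rule that[of "t - of_int s"])
  show "(t - of_int s) * (t - of_int s) = 0"
    using t by (intro witt0_eq_0_mult[OF char]) auto
  show "3 * (t - of_int s) = 0"
    using three_mult_witt2_cong[OF char, of "t - of_int s" 0] t by simp
qed simp

lemma witt2_cube:
  fixes t :: "'a::comm_ring_1 witt2"
  assumes char: "CHAR('a) = 3" and t: "witt0 t = of_int s"
  shows "t ^ 3 = of_int s ^ 3"
proof -
  obtain d where d: "t = of_int s + d" "d * d = 0" "3 * d = 0"
    using witt2_prime_field_decomp[OF assms] .
  have "(of_int s + d) ^ 3 =
      of_int s ^ 3 + (of_int s)\<^sup>2 * (3 * d) + (3 * of_int s + d) * (d * d)"
    by (simp add: algebra_simps power2_eq_square power3_eq_cube)
  then show ?thesis using d by simp
qed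

lemma prime_field_of_int:
  assumes "CHAR('a::comm_ring_1) = 3" "(t::'a) \<in> {0, 1, 2}"
  obtains s :: int where "s \<in> {0, 1, - 1}" "t = of_int s"
  using assms(2) two_in_char_3(1)[OF assms(1)] that[of 0] that[of 1] that[of "-1"] by auto

text \<open>
  The polynomial \<open>f = 2 X ^ 4 - X ^ 2\<close> takes the values 0, 1, 1 at 0, 1, -1, and at these points its
  derivative is divisible by 3, so \<open>f\<close> is unchanged by the correction \<open>d\<close>. Degree four is the
  least possible for such an indicator modulo 9, which keeps the later expansions short.
\<close>
lemma witt2_indicator:
  fixes t :: "'a::comm_ring_1 witt2"
  assumes char: "CHAR('a) = 3" and t: "witt0 t \<in> {0, 1, 2}"
  shows "2 * t ^ 4 - t ^ 2 = (if witt0 t = 0 then 0 else 1)"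
proof -
  obtain s :: int where s: "s \<in> {0, 1, - 1}" "witt0 t = of_int s"
    using prime_field_of_int[OF assms] .
  obtain d where d: "t = of_int s + d" "d * d = 0" "3 * d = 0"
    using witt2_prime_field_decomp[OF char s(2)] .
  define S :: "'a witt2" where "S = of_int s"
  have "t = S + d" using d(1) by (simp add: S_def)
  have sq: "t ^ 2 = S ^ 2 + 2 * S * d"
    using d(2) by (simp add: \<open>t = S + d\<close> power2_eq_square algebra_simps)
  have "t ^ 4 = (t ^ 2) ^ 2" by simp
  also have "\<dots> = S ^ 4 + 4 * S ^ 3 * d + 4 * S ^ 2 * (d * d)"
    unfolding sq by (simp add: power2_eq_square power3_eq_cube algebra_simps power4_eq_xxxx)
  finally have "2 * t ^ 4 - t ^ 2 = (2 * S ^ 4 - S ^ 2) + (8 * S ^ 3 - 2 * S) * d"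
    using d(2) by (simp add: sq algebra_simps)
  also have "(8 * S ^ 3 - 2 * S) * d = 0"
  proof -
    have "8 * S ^ 3 - 2 * S = 2 * S * 3"
      using s(1) by (auto simp: S_def)
    then have "(8 * S ^ 3 - 2 * S) * d = 2 * S * (3 * d)" by (simp only: mult.assoc)
    then show ?thesis unfolding d(3) by simp
  qed
  also have "(2 * S ^ 4 - S ^ 2) = (if witt0 t = 0 then 0 else 1)"
    using s by (auto simp: S_def)
  finally show ?thesis by simp
qed

section \<open>Power sums of Teichmueller lifts\<close>

lemma power_card_minus_1:
  assumes "(x :: 'a::finite_field) \<noteq> 0"
  shows "x ^ (CARD('a) - 1) = 1"
proof -
  have "x * x ^ (CARD('a) - 1) = x ^ CARD('a)"
    by (metis power_minus_mult mult.commute zero_less_card_finite)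
  then show ?thesis using assms finite_field_power_card_eq_same[of x] by simp
qed

text \<open>
  Two monomials of different degrees below \<open>CARD('a) - 1\<close> cannot agree at all \<open>CARD('a) - 1\<close> nonzero
  points, since their difference has too few roots.
\<close>
lemma power_eq_iff_cong:
  "(\<forall>x::'a::finite_field. x \<noteq> 0 \<longrightarrow> x ^ m = x ^ k) \<longleftrightarrow> [m = k] (mod (CARD('a) - 1))"
proof -
  define N where "N = CARD('a) - 1"
  have "card {0, 1 :: 'a} \<le> CARD('a)" by (rule card_mono) auto
  then have N: "N > 0" by (simp add: N_def)
  have red: "x ^ m = x ^ (m mod N)" if "x \<noteq> 0" for x :: 'a and m
  proof -
    have "x ^ m = (x ^ N) ^ (m div N) * x ^ (m mod N)"
      by (simp flip: power_mult power_add)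
    then show ?thesis using power_card_minus_1[OF that] by (simp add: N_def)
  qed
  have "m mod N = k mod N" if *: "\<forall>x::'a. x \<noteq> 0 \<longrightarrow> x ^ m = x ^ k"
  proof (rule ccontr)
    assume neq: "m mod N \<noteq> k mod N"
    define p :: "'a poly" where "p = monom 1 (m mod N) - monom 1 (k mod N)"
    have "coeff p (m mod N) = 1" using neq by (simp add: p_def)
    then have p: "p \<noteq> 0" by auto
    have "degree p < N"
      unfolding p_def using N
      by (intro degree_diff_less) (auto simp: degree_monom_eq)
    moreover have "card {x. poly p x = 0} \<le> degree p"
      using p by (rule card_poly_roots_bound)
    moreover have "card (UNIV - {0 :: 'a}) \<le> card {x. poly p x = 0}"
      using * by (intro card_mono) (auto simp: p_def poly_monom red[symmetric])
    moreover have "card (UNIV - {0 :: 'a}) = N"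
      by (simp add: N_def card_Diff_singleton)
    ultimately show False by simp
  qed
  moreover have "\<forall>x::'a. x \<noteq> 0 \<longrightarrow> x ^ m = x ^ k" if "m mod N = k mod N"
    using that red by metis
  ultimately show ?thesis unfolding cong_def N_def by blast
qed

lemma card_eq_0_witt2:
  assumes "CARD('a::finite_field) = 3 ^ n" "n \<ge> 2"
  shows "(of_nat CARD('a) :: 'a witt2) = 0"
proof -
  obtain m where "n = 2 + m" using assms(2) le_Suc_ex by blast
  then have "(3::'a witt2) ^ n = 9 * 3 ^ m" by (simp add: power_add)
  then show ?thesis
    using nine_eq_0_witt2[OF CHAR_eq_3[OF assms(1)]] by (simp add: assms(1))
qed

text \<open>
  For \<open>m > 0\<close> the term at \<open>x = 0\<close> vanishes, and the remaining sum is that of the character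
  \<open>x ^ (m - k)\<close> over the multiplicative group: 0 if the character is nontrivial, and otherwise
  \<open>3 ^ n - 1\<close>, which equals \<open>- 1\<close> because 9 divides \<open>3 ^ n\<close>.
\<close>
lemma sum_teich_orthogonality:
  fixes m k :: nat
  assumes card: "CARD('a::finite_field) = 3 ^ n" and n: "n \<ge> 2" and "m > 0"
  shows "(\<Sum>x\<in>UNIV. teich (x ^ m) * teich (inverse x ^ k) :: 'a witt2) =
    (if [m = k] (mod (3 ^ n - 1)) then - 1 else 0)"
proof -
  have char: "CHAR('a) = 3" using CHAR_eq_3[OF card] .
  let ?f = "\<lambda>x::'a. teich (x ^ m * inverse x ^ k)"
  have "(\<Sum>x\<in>UNIV. teich (x ^ m) * teich (inverse x ^ k)) = (\<Sum>x\<in>UNIV. ?f x)"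
    by (simp add: teich_mult)
  also have "\<dots> = (\<Sum>x\<in>UNIV - {0}. ?f x)"
    using \<open>m > 0\<close> by (intro sum.mono_neutral_right) (auto simp: power_0_left)
  also have "\<dots> = (if [m = k] (mod (3 ^ n - 1)) then - 1 else 0)"
  proof (cases "[m = k] (mod (3 ^ n - 1))")
    case True
    then have "x ^ m = x ^ k" if "x \<noteq> 0" for x :: 'a
      using that power_eq_iff_cong[of m k, where 'a = 'a] unfolding card by blast
    then have "?f x = 1" if "x \<noteq> 0" for x :: 'a
      using that by (simp add: power_inverse)
    then have "(\<Sum>x\<in>UNIV - {0}. ?f x) = (\<Sum>x\<in>UNIV - {0::'a}. 1)"
      by (intro sum.cong) auto
    also have "\<dots> = of_nat (CARD('a) - 1)"
      by (simp add: card_Diff_singleton)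
    also have "\<dots> = of_nat CARD('a) - (1 :: 'a witt2)"
      by simp
    finally show ?thesis using card_eq_0_witt2[OF card n] True by simp
  next
    case False
    then obtain g :: 'a where g: "g \<noteq> 0" "g ^ m \<noteq> g ^ k"
      using power_eq_iff_cong[of m k, where 'a = 'a] unfolding card by blast
    define c where "c = g ^ m * inverse g ^ k"
    have c: "c \<noteq> 1" using g by (auto simp: c_def field_simps)
    \<comment> \<open>The substitution \<open>x \<mapsto> g x\<close> permutes the nonzero elements and multiplies the sum by
      \<open>teich c\<close>.\<close>
    have "(\<Sum>x\<in>UNIV - {0}. ?f x) = (\<Sum>x\<in>UNIV - {0}. ?f (g * x))"
      using g(1)
      by (intro sum.reindex_bij_witness[of _ "\<lambda>x. g * x" "\<lambda>x. x / g"]) auto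
    also have "\<dots> = teich c * (\<Sum>x\<in>UNIV - {0}. ?f x)"
      unfolding sum_distrib_left teich_mult[symmetric]
      by (intro sum.cong refl arg_cong[of _ _ teich])
        (simp add: c_def power_mult_distrib mult_ac)
    finally have "(\<Sum>x\<in>UNIV - {0}. ?f x) = teich c * (\<Sum>x\<in>UNIV - {0}. ?f x)" .
    then have "(teich c - 1) * (\<Sum>x\<in>UNIV - {0}. ?f x) = 0"
      by (simp only: left_diff_distrib mult_1 right_minus_eq)
    then have "(\<Sum>x\<in>UNIV - {0}. ?f x) = 0"
      by (rule witt2_mult_eq_0_cancel[OF char, rotated]) (use c in simp)
    then show ?thesis using False by simp
  qed
  finally show ?thesis .
qed

text \<open>
  Orthogonality in the form in which it is applied: the powers of \<open>T(b/x)\<close> and \<open>T(c x)\<close> are finite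
  combinations of powers of the lifts of \<open>1/x\<close> and \<open>x\<close>, indexed by tuples \<open>u\<close> and \<open>v\<close>, and only the
  pairs with matching exponents contribute.
\<close>
lemma bilinear_teich_sum:
  fixes f :: "'i \<Rightarrow> 'a::finite_field witt2" and g :: "'j \<Rightarrow> 'a witt2"
  assumes card: "CARD('a) = 3 ^ n" and n: "n \<ge> 2" and r: "\<And>v. v \<in> J \<Longrightarrow> r v > (0::nat)"
    and fin: "finite I"
  shows "(\<Sum>x\<in>UNIV. (\<Sum>u\<in>I. f u * teich (inverse x ^ p u)) * (\<Sum>v\<in>J. g v * teich (x ^ r v))) =
    - (\<Sum>v\<in>J. g v * (\<Sum>u\<in>{u \<in> I. [r v = p u] (mod (3 ^ n - 1))}. f u))"
proof -
  have "(\<Sum>x\<in>UNIV. (\<Sum>u\<in>I. f u * teich (inverse x ^ p u)) * (\<Sum>v\<in>J. g v * teich (x ^ r v))) =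
    (\<Sum>x\<in>UNIV. \<Sum>v\<in>J. \<Sum>u\<in>I. g v * f u * (teich (x ^ r v) * teich (inverse x ^ p u)))"
    by (simp add: mult.commute[of "sum _ I"] sum_product mult_ac)
  also have "\<dots> = (\<Sum>v\<in>J. \<Sum>x\<in>UNIV. \<Sum>u\<in>I. g v * f u * (teich (x ^ r v) * teich (inverse x ^ p u)))"
    by (rule sum.swap)
  also have "\<dots> = (\<Sum>v\<in>J. \<Sum>u\<in>I. \<Sum>x\<in>UNIV. g v * f u * (teich (x ^ r v) * teich (inverse x ^ p u)))"
    by (intro sum.cong refl sum.swap)
  also have "\<dots> = (\<Sum>v\<in>J. \<Sum>u\<in>I. g v * f u * (\<Sum>x\<in>UNIV. teich (x ^ r v) * teich (inverse x ^ p u)))"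
    by (simp only: sum_distrib_left)
  also have "\<dots> = (\<Sum>v\<in>J. \<Sum>u\<in>I. if [r v = p u] (mod (3 ^ n - 1)) then - (g v * f u) else 0)"
    by (intro sum.cong refl) (simp add: sum_teich_orthogonality[OF card n r])
  also have "\<dots> = - (\<Sum>v\<in>J. g v * (\<Sum>u\<in>{u \<in> I. [r v = p u] (mod (3 ^ n - 1))}. f u))"
    using fin by (simp add: sum.inter_filter[symmetric] sum_negf[symmetric] sum_distrib_left
        if_distrib[of uminus] if_distrib[of "times _"] cong: if_cong)
  finally show ?thesis .
qed

section \<open>Sums of few powers of three\<close>

text \<open>
  In this and the next two lemmas, dividing by 3 lowers all exponents at once, unless some exponent
  is 0; then the numbers of vanishing exponents on both sides must agree modulo 3.
\<close>
lemma two_powers_of_3_eq_iff: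
  "(3::nat) ^ i + 3 ^ j = 3 ^ k + 3 ^ l \<longleftrightarrow> i = k \<and> j = l \<or> i = l \<and> j = k"
proof
  show "3 ^ i + 3 ^ j = (3::nat) ^ k + 3 ^ l \<Longrightarrow> i = k \<and> j = l \<or> i = l \<and> j = k"
  proof (induction i arbitrary: j k l)
    case 0
    then show ?case by (cases j; cases k; cases l) (simp_all, presburger+)
  next
    case (Suc i)
    show ?case
    proof (cases "j = 0 \<or> k = 0 \<or> l = 0")
      case True
      then show ?thesis using Suc.prems by (cases j; cases k; cases l) (simp_all, presburger+)
    next
      case False
      then show ?thesis using Suc.prems Suc.IH[of "j - 1" "k - 1" "l - 1"]
        by (cases j; cases k; cases l) auto
    qed
  qed
qed auto

lemma three_powers_of_3_eq_power:
  assumes "(3::nat) ^ i + 3 ^ j + 3 ^ k = 3 ^ l"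
  shows "i = j \<and> j = k \<and> l = Suc i"
  using assms
proof (induction l arbitrary: i j k)
  case 0
  have "(3::nat) ^ i \<ge> 1" "(3::nat) ^ j \<ge> 1" "(3::nat) ^ k \<ge> 1" by simp_all
  with 0 have False unfolding power_0 by linarith
  then show ?case ..
next
  case (Suc l)
  show ?case
  proof (cases "i = 0 \<or> j = 0 \<or> k = 0")
    case True
    then have "i = 0 \<and> j = 0 \<and> k = 0"
      using Suc.prems by (cases i; cases j; cases k) (simp_all, presburger+)
    then show ?thesis using Suc.prems by (cases l) (simp_all, presburger)
  next
    case False
    then show ?thesis using Suc.prems Suc.IH[of "i - 1" "j - 1" "k - 1"]
      by (cases i; cases j; cases k) auto
  qed
qed

lemma three_distinct_powers_of_3_eq:
  assumes "i < j" "j < k" "i' < j'" "j' < k'"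
    and "(3::nat) ^ i + 3 ^ j + 3 ^ k = 3 ^ i' + 3 ^ j' + 3 ^ k'"
  shows "i = i' \<and> j = j' \<and> k = k'"
  using assms
proof (induction i arbitrary: j k i' j' k')
  case 0
  have "i' = 0"
    using 0 by (cases j; cases k; cases i'; cases j'; cases k') (simp_all, presburger+)
  then have "3 ^ j + 3 ^ k = (3::nat) ^ j' + 3 ^ k'" using 0 by simp
  then show ?case using 0 \<open>i' = 0\<close> unfolding two_powers_of_3_eq_iff by auto
next
  case (Suc i)
  have "i' \<noteq> 0"
    using Suc.prems by (cases j; cases k; cases i'; cases j'; cases k') (simp_all, presburger+)
  then show ?case using Suc.prems Suc.IH[of "j - 1" "k - 1" "i' - 1" "j' - 1" "k' - 1"]
    by (cases j; cases k; cases i'; cases j'; cases k') auto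
qed

text \<open>
  The sums of powers below are so small compared with \<open>3 ^ n - 1\<close> that a congruence forces equality,
  except for wrapping around once.
\<close>
lemma cong_close_imp_eq_nat:
  fixes x y N :: nat
  assumes "[x = y] (mod N)" "x < y + N" "y < x + N"
  shows "x = y"
proof -
  have "int N dvd int x - int y" using assms(1) by (simp add: cong_iff_dvd_diff flip: cong_int_iff)
  moreover have "\<bar>int x - int y\<bar> < int N" using assms by auto
  ultimately show ?thesis using dvd_imp_le_int[of "int x - int y" "int N"] by fastforce
qed

lemma power_3_bounds:
  fixes i n :: nat
  assumes "i < n"
  shows "1 \<le> (3::nat) ^ i" "3 * 3 ^ i \<le> (3::nat) ^ n"
  using assms power_increasing[of "Suc i" n "3::nat"] by auto

lemma cong_power_3:
  assumes "k < n" "i < n"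
  shows "[3 ^ k = 3 ^ i] (mod (3 ^ n - 1 :: nat)) \<longleftrightarrow> i = k"
proof
  assume "[3 ^ k = 3 ^ i] (mod (3 ^ n - 1 :: nat))"
  then have "(3::nat) ^ k = 3 ^ i"
    by (rule cong_close_imp_eq_nat)
      (use assms[THEN power_3_bounds(1)] assms[THEN power_3_bounds(2)] in linarith)+
  then show "i = k" by simp
qed auto

lemma cong_two_powers_3:
  assumes "k < n" "l < n" "i < n" "j < n"
  shows "[3 ^ k + 3 ^ l = 3 ^ i + 3 ^ j] (mod (3 ^ n - 1 :: nat)) \<longleftrightarrow>
    i = k \<and> j = l \<or> i = l \<and> j = k"
proof
  assume "[3 ^ k + 3 ^ l = 3 ^ i + 3 ^ j] (mod (3 ^ n - 1 :: nat))"
  then have "(3::nat) ^ k + 3 ^ l = 3 ^ i + 3 ^ j"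
    by (rule cong_close_imp_eq_nat)
      (use assms[THEN power_3_bounds(1)] assms[THEN power_3_bounds(2)] in linarith)+
  then show "i = k \<and> j = l \<or> i = l \<and> j = k"
    unfolding two_powers_of_3_eq_iff by auto
qed (auto simp: add.commute)

lemma not_cong_two_powers_3:
  assumes "i < n" "j < n" "n \<ge> 2"
  shows "\<not> [3 ^ i + 3 ^ j = 0] (mod (3 ^ n - 1 :: nat))"
proof
  assume "[3 ^ i + 3 ^ j = 0] (mod (3 ^ n - 1 :: nat))"
  moreover have "(9::nat) \<le> 3 ^ n" using power_increasing[of 2 n "3::nat"] assms by simp
  ultimately have "(3::nat) ^ i + 3 ^ j = 0"
    by (elim cong_close_imp_eq_nat)
      (use power_3_bounds[OF assms(1)] power_3_bounds[OF assms(2)] in linarith)+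
  then show False by simp
qed

lemma cong_three_powers_3:
  assumes "l < n" "i < n" "j < n" "k < n"
  shows "[3 ^ l = 3 ^ i + 3 ^ j + 3 ^ k] (mod (3 ^ n - 1 :: nat)) \<longleftrightarrow>
    i = j \<and> j = k \<and> l = Suc i mod n"
proof
  let ?S = "3 ^ i + 3 ^ j + 3 ^ k :: nat"
  assume cong: "[3 ^ l = ?S] (mod (3 ^ n - 1 :: nat))"
  note b = assms[THEN power_3_bounds(1)] assms[THEN power_3_bounds(2)]
  show "i = j \<and> j = k \<and> l = Suc i mod n"
  proof (cases "?S < 3 ^ l + (3 ^ n - 1)")
    case True
    with cong have "3 ^ l = ?S"
      by (elim cong_close_imp_eq_nat) (use b in linarith)+
    then have "i = j \<and> j = k \<and> l = Suc i"
      using three_powers_of_3_eq_power[of i j k l] by simp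
    then show ?thesis using assms by simp
  next
    case False
    then have "?S = 3 ^ n" "(3::nat) ^ l = 1" using b by linarith+
    then have "i = j \<and> j = k \<and> n = Suc i" "l = 0"
      using three_powers_of_3_eq_power[of i j k n] by simp_all
    then show ?thesis by simp
  qed
next
  assume *: "i = j \<and> j = k \<and> l = Suc i mod n"
  show "[3 ^ l = 3 ^ i + 3 ^ j + 3 ^ k] (mod (3 ^ n - 1 :: nat))"
  proof (cases "Suc i = n")
    case True
    then have "3 ^ i + 3 ^ j + 3 ^ k = (3::nat) ^ n" "l = 0"
      using * by auto
    then have "3 ^ i + 3 ^ j + 3 ^ k = 3 ^ l + (3 ^ n - 1 :: nat)" by simp
    then show ?thesis by (simp only: cong_def mod_add_self2)
  next
    case False
    then have "l = Suc i" using * assms by simp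
    then have "3 ^ l = (3 ^ i + 3 ^ j + 3 ^ k :: nat)" using * by simp
    then show ?thesis by (simp only: cong_refl)
  qed
qed

text \<open>
  The only positive multiple of \<open>3 ^ n - 1\<close> in reach is \<open>3 ^ n - 1\<close> itself, whose three lowest digits
  are all 2. At least six powers of three are needed to produce them.
\<close>
lemma not_cong_four_powers_3:
  assumes "n \<ge> 3" "i < n" "j < n" "k < n" "l < n"
  shows "\<not> [3 ^ i + 3 ^ j + (3 ^ k + 3 ^ l) = 0] (mod (3 ^ n - 1 :: nat))"
proof
  let ?S = "3 ^ i + 3 ^ j + (3 ^ k + 3 ^ l) :: nat"
  have n27: "27 dvd (3::nat) ^ n" using le_imp_power_dvd[of 3 n "3::nat"] assms(1) by simp
  then have n27': "27 \<le> (3::nat) ^ n" by (intro dvd_imp_le) auto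
  assume "[?S = 0] (mod (3 ^ n - 1))"
  then have "[?S = 3 ^ n - 1] (mod (3 ^ n - 1))" by (simp add: cong_def)
  then have "?S = 3 ^ n - 1"
    by (rule cong_close_imp_eq_nat)
      (use n27' assms(2-)[THEN power_3_bounds(1)] assms(2-)[THEN power_3_bounds(2)] in linarith)+
  then have "?S + 1 = 3 ^ n" using n27' by linarith
  then have "(?S + 1) mod 27 = 0" using n27 by (simp only: dvd_eq_mod_eq_0)
  moreover have "[3 ^ i mod 27 + 3 ^ j mod 27 + (3 ^ k mod 27 + 3 ^ l mod 27) + 1 = ?S + 1] (mod 27)"
    by (intro cong_add) (simp_all add: cong_def)
  moreover have "(3::nat) ^ e mod 27 \<in> {0, 1, 3, 9}" for e
  proof (cases "e < 3")
    case True
    then have "e = 0 \<or> e = 1 \<or> e = 2" by auto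
    then show ?thesis by auto
  next
    case False
    then have "27 dvd (3::nat) ^ e" using le_imp_power_dvd[of 3 e "3::nat"] by simp
    then show ?thesis by simp
  qed
  moreover have "(w + x + (y + z) + 1) mod 27 \<noteq> 0"
    if "w \<in> {0, 1, 3, 9}" "x \<in> {0, 1, 3, 9}" "y \<in> {0, 1, 3, 9}" "z \<in> {0, 1, 3, 9}"
    for w x y z :: nat
    using that by auto
  ultimately show False unfolding cong_def by metis
qed

section \<open>Moments of the lifted trace\<close>

text \<open>The Witt vector trace of the Teichmueller lift of \<open>y\<close>, abbreviated to \<open>T(y)\<close> in explanations.\<close>
definition wtrace :: "nat \<Rightarrow> 'a::finite_field \<Rightarrow> 'a witt2" where
  "wtrace n y = (\<Sum>i<n. teich (y ^ 3 ^ i))"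

lemma witt0_wtrace [simp]: "witt0 (wtrace n y) = abs_trace n y"
  by (simp add: wtrace_def abs_trace_def)

lemma wtrace_mult: "wtrace n (b * y) = (\<Sum>i<n. teich (b ^ 3 ^ i) * teich (y ^ 3 ^ i))"
  by (simp add: wtrace_def power_mult_distrib teich_mult)

lemma teich_sum_product:
  "(\<Sum>u\<in>I. teich (b ^ p u) * teich (y ^ p u)) * (\<Sum>v\<in>J. teich (b ^ r v) * teich (y ^ r v)) =
    (\<Sum>w\<in>I \<times> J. teich (b ^ (p (fst w) + r (snd w))) * teich (y ^ (p (fst w) + r (snd w))))"
  unfolding sum_product sum.cartesian_product
  by (intro sum.cong) (auto simp: power_add teich_mult mult_ac)

lemma wtrace_mult_power2:
  "wtrace n (b * y) ^ 2 = (\<Sum>w\<in>{..<n} \<times> {..<n}.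
    teich (b ^ (3 ^ fst w + 3 ^ snd w)) * teich (y ^ (3 ^ fst w + 3 ^ snd w)))"
  by (simp add: power2_eq_square wtrace_mult teich_sum_product)

lemma wtrace_mult_power3:
  "wtrace n (b * y) ^ 3 = (\<Sum>w\<in>({..<n} \<times> {..<n}) \<times> {..<n}.
    teich (b ^ (3 ^ fst (fst w) + 3 ^ snd (fst w) + 3 ^ snd w)) *
    teich (y ^ (3 ^ fst (fst w) + 3 ^ snd (fst w) + 3 ^ snd w)))"
  using teich_sum_product[of b "\<lambda>w. 3 ^ fst w + 3 ^ snd w" y "{..<n} \<times> {..<n}" "\<lambda>i. 3 ^ i" "{..<n}"]
  by (simp add: power3_eq_cube wtrace_mult teich_sum_product)

lemma wtrace_mult_power4:
  "wtrace n (b * y) ^ 4 = (\<Sum>w\<in>({..<n} \<times> {..<n}) \<times> ({..<n} \<times> {..<n}).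
    teich (b ^ (3 ^ fst (fst w) + 3 ^ snd (fst w) + (3 ^ fst (snd w) + 3 ^ snd (snd w)))) *
    teich (y ^ (3 ^ fst (fst w) + 3 ^ snd (fst w) + (3 ^ fst (snd w) + 3 ^ snd (snd w)))))"
proof -
  have "wtrace n (b * y) ^ 4 = wtrace n (b * y) ^ 2 * wtrace n (b * y) ^ 2" by (simp flip: power_add)
  then show ?thesis unfolding wtrace_mult_power2 teich_sum_product .
qed

lemma wtrace_cube_arg:
  assumes "CARD('a::finite_field) = 3 ^ n"
  shows "wtrace n (y ^ 3 :: 'a) = wtrace n y"
proof -
  have "wtrace n (y ^ 3) = (\<Sum>i<n. teich (y ^ 3 ^ Suc i))"
    by (simp add: wtrace_def flip: power_mult)
  also have "\<dots> = (\<Sum>i<n. teich (y ^ 3 ^ i)) - teich y + teich (y ^ 3 ^ n)"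
    using sum.lessThan_Suc_shift[of "\<lambda>i. teich (y ^ 3 ^ i)" n]
      sum.lessThan_Suc[of "\<lambda>i. teich (y ^ 3 ^ i)" n]
    by (simp add: algebra_simps)
  also have "y ^ 3 ^ n = y" using finite_field_power_card_eq_same[of y] assms by simp
  finally show ?thesis by (simp add: wtrace_def)
qed

lemma sum_inverse_UNIV:
  fixes F :: "'a::finite_field \<Rightarrow> 'b::comm_monoid_add"
  shows "(\<Sum>x\<in>UNIV. F (inverse x)) = (\<Sum>x\<in>UNIV. F x)"
  by (rule sum.reindex_bij_witness[of _ inverse inverse]) auto

context
  fixes n :: nat and field_type :: "'a::finite_field itself"
  assumes card: "CARD('a) = 3 ^ n" and n: "n \<ge> 3"
begin

text \<open>
  The coefficients \<open>b\<close> and \<open>c\<close> are kept symmetric: with \<open>x \<mapsto> 1/x\<close>, the moment of order \<open>(1, 3)\<close>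
  is then an instance of the one of order \<open>(3, 1)\<close>, also if a coefficient vanishes.
\<close>
lemma moment_0_2: "(\<Sum>x\<in>UNIV. wtrace n (c * x :: 'a) ^ 2) = 0"
proof -
  \<comment> \<open>The empty product of powers of \<open>1/x\<close> is written as a one-term sum with exponent 0.\<close>
  have "(\<Sum>x\<in>UNIV. (\<Sum>u\<in>{()}. 1 * teich (inverse x ^ 0)) *
      (\<Sum>w\<in>{..<n} \<times> {..<n}. teich (c ^ (3 ^ fst w + 3 ^ snd w)) * teich (x ^ (3 ^ fst w + 3 ^ snd w)))) = 0"
    by (subst bilinear_teich_sum[OF card])
      (use n in \<open>auto simp: not_cong_two_powers_3 simp del: One_nat_def intro!: sum.neutral\<close>)
  then show ?thesis by (simp add: wtrace_mult_power2)
qed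

lemma moment_0_4: "(\<Sum>x\<in>UNIV. wtrace n (c * x :: 'a) ^ 4) = 0"
proof -
  have "(\<Sum>x\<in>UNIV. (\<Sum>u\<in>{()}. 1 * teich (inverse x ^ 0)) *
      (\<Sum>w\<in>({..<n} \<times> {..<n}) \<times> ({..<n} \<times> {..<n}).
        teich (c ^ (3 ^ fst (fst w) + 3 ^ snd (fst w) + (3 ^ fst (snd w) + 3 ^ snd (snd w)))) *
        teich (x ^ (3 ^ fst (fst w) + 3 ^ snd (fst w) + (3 ^ fst (snd w) + 3 ^ snd (snd w)))))) = 0"
    by (subst bilinear_teich_sum[OF card])
      (use n in \<open>auto simp: not_cong_four_powers_3 simp del: One_nat_def intro!: sum.neutral\<close>)
  then show ?thesis by (simp add: wtrace_mult_power4)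
qed

lemma moment_1_1:
  "(\<Sum>x\<in>UNIV. wtrace n (b * inverse x) * wtrace n (c * x :: 'a)) = - wtrace n (b * c)"
proof -
  have "{u \<in> {..<n}. [3 ^ v = 3 ^ u] (mod (3 ^ n - 1 :: nat))} = {v}" if "v < n" for v
    using that by (auto simp: cong_power_3 simp del: One_nat_def)
  then show ?thesis
    unfolding wtrace_mult using n
    by (subst bilinear_teich_sum[OF card]) (auto simp: mult.commute simp del: One_nat_def)
qed

text \<open>
  Three powers of three add up to \<open>3 ^ v\<close> modulo \<open>3 ^ n - 1\<close> only if all three are the cyclic predecessor
  of \<open>3 ^ v\<close>, which leaves one term for each \<open>v\<close>.
\<close>
lemma moment_3_1:
  "(\<Sum>x\<in>UNIV. wtrace n (b * inverse x) ^ 3 * wtrace n (c * x :: 'a)) = - wtrace n (b * c)"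
proof -
  let ?I = "({..<n} \<times> {..<n}) \<times> {..<n}"
  have *: "(\<Sum>u\<in>{u \<in> ?I. [3 ^ v = 3 ^ fst (fst u) + 3 ^ snd (fst u) + 3 ^ snd u] (mod (3 ^ n - 1 :: nat))}.
      teich (b ^ (3 ^ fst (fst u) + 3 ^ snd (fst u) + 3 ^ snd u))) = teich (b ^ 3 ^ v)" if v: "v < n" for v
  proof -
    \<comment> \<open>For \<open>v = 0\<close> the predecessor is \<open>n - 1\<close>, since \<open>3 ^ n\<close> is 1 modulo \<open>3 ^ n - 1\<close>.\<close>
    define i where "i = (if v = 0 then n - 1 else v - 1)"
    have i: "i < n" "\<And>i'. i' < n \<Longrightarrow> v = Suc i' mod n \<longleftrightarrow> i' = i"
      using v n by (auto simp: i_def mod_Suc)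
    have "{u \<in> ?I. [3 ^ v = 3 ^ fst (fst u) + 3 ^ snd (fst u) + 3 ^ snd u] (mod (3 ^ n - 1 :: nat))} = {((i, i), i)}"
      using v n i by (auto simp: cong_three_powers_3 simp del: One_nat_def)
    moreover have "b ^ (3 ^ i + 3 ^ i + 3 ^ i) = b ^ 3 ^ v"
    proof (cases "v = 0")
      case True
      then have "3 ^ i + 3 ^ i + 3 ^ i = (3::nat) ^ n" using n by (cases n) (auto simp: i_def)
      then show ?thesis using True finite_field_power_card_eq_same[of b] card by simp
    next
      case False
      then have "3 ^ i + 3 ^ i + 3 ^ i = (3::nat) ^ v" by (cases v) (auto simp: i_def)
      then show ?thesis by simp
    qed
    ultimately show ?thesis by simp
  qed
  show ?thesis
    unfolding wtrace_mult_power3 unfolding wtrace_mult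
    using n by (subst bilinear_teich_sum[OF card]) (auto simp: * mult.commute simp del: One_nat_def)
qed

text \<open>
  The exponent of a pair \<open>(k, l)\<close> is matched by \<open>(k, l)\<close> and \<open>(l, k)\<close>. Counting both contributes
  \<open>2 T(b c) ^ 2\<close>, and the diagonal, where they coincide, has been counted once too often.
\<close>
lemma moment_2_2:
  "(\<Sum>x\<in>UNIV. wtrace n (b * inverse x) ^ 2 * wtrace n (c * x :: 'a) ^ 2) =
    wtrace n ((b * c) ^ 2) - 2 * wtrace n (b * c) ^ 2"
proof -
  let ?I = "{..<n} \<times> {..<n}"
  define e :: "nat \<times> nat \<Rightarrow> nat" where "e = (\<lambda>w. 3 ^ fst w + 3 ^ snd w)"
  have e: "teich (c ^ e v) * (\<Sum>u\<in>{u \<in> ?I. [e v = e u] (mod (3 ^ n - 1))}. teich (b ^ e u)) =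
      2 * (teich (b ^ e v) * teich (c ^ e v)) -
        (if fst v = snd v then teich (b ^ e v) * teich (c ^ e v) else 0)" if v: "v \<in> ?I" for v
  proof -
    have "{u \<in> ?I. [e v = e u] (mod (3 ^ n - 1))} = {(fst v, snd v), (snd v, fst v)}"
      using v n by (auto simp: cong_two_powers_3 e_def simp del: One_nat_def)
    moreover have "e (snd v, fst v) = e v" by (simp add: e_def)
    ultimately show ?thesis by (cases v) (auto simp: algebra_simps)
  qed
  have diag: "(\<Sum>v\<in>?I. if fst v = snd v then teich (b ^ e v) * teich (c ^ e v) else 0) =
      wtrace n ((b * c) ^ 2)"
  proof -
    have "(\<Sum>v\<in>?I. if fst v = snd v then teich (b ^ e v) * teich (c ^ e v) else 0) =
        (\<Sum>i<n. \<Sum>j<n. if i = j then teich (b ^ e (i, j)) * teich (c ^ e (i, j)) else 0)"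
      unfolding sum.cartesian_product by (intro sum.cong) auto
    also have "\<dots> = (\<Sum>i<n. teich (b ^ e (i, i)) * teich (c ^ e (i, i)))"
      by simp
    also have "\<dots> = wtrace n ((b * c) ^ 2)"
      unfolding wtrace_def e_def
      by (intro sum.cong)
        (auto simp: power_mult_distrib mult_2[symmetric] simp flip: power_mult teich_mult)
    finally show ?thesis .
  qed
  have "(\<Sum>x\<in>UNIV. wtrace n (b * inverse x) ^ 2 * wtrace n (c * x :: 'a) ^ 2) =
      - (\<Sum>v\<in>?I. teich (c ^ e v) * (\<Sum>u\<in>{u \<in> ?I. [e v = e u] (mod (3 ^ n - 1))}. teich (b ^ e u)))"
    unfolding wtrace_mult_power2 e_def[symmetric]
    using n by (subst bilinear_teich_sum[OF card]) (auto simp: e_def)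
  also have "\<dots> = wtrace n ((b * c) ^ 2) - 2 * (\<Sum>v\<in>?I. teich (b ^ e v) * teich (c ^ e v))"
    using e diag by (simp add: sum_subtractf sum_distrib_left cong: sum.cong)
  also have "(\<Sum>v\<in>?I. teich (b ^ e v) * teich (c ^ e v)) = wtrace n (b * c) ^ 2"
    unfolding wtrace_mult_power2 e_def ..
  finally show ?thesis .
qed

lemma sum_wtrace_power2:
  "(\<Sum>x\<in>UNIV. (wtrace n (inverse x) + wtrace n (a * x :: 'a)) ^ 2) = - 2 * wtrace n a"
proof -
  have "(\<Sum>x\<in>UNIV. (wtrace n (inverse x) + wtrace n (a * x)) ^ 2) =
    (\<Sum>x\<in>UNIV. wtrace n (inverse x) ^ 2) + 2 * (\<Sum>x\<in>UNIV. wtrace n (inverse x) * wtrace n (a * x))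
      + (\<Sum>x\<in>UNIV. wtrace n (a * x) ^ 2)"
    by (simp add: power2_sum sum.distrib sum_distrib_left mult_ac)
  then show ?thesis
    using moment_0_2[of 1] moment_0_2[of a] moment_1_1[of 1 a]
      sum_inverse_UNIV[of "\<lambda>x::'a. wtrace n x ^ 2"] by simp
qed

lemma sum_wtrace_power4:
  "(\<Sum>x\<in>UNIV. (wtrace n (inverse x) + wtrace n (a * x :: 'a)) ^ 4) =
    - 8 * wtrace n a + 6 * (wtrace n (a ^ 2) - 2 * wtrace n a ^ 2)"
proof -
  have binom: "(A + B) ^ 4 = A ^ 4 + 4 * (A ^ 3 * B) + 6 * (A ^ 2 * B ^ 2) + 4 * (B ^ 3 * A) + B ^ 4"
    for A B :: "'a witt2"
    by (simp add: power2_eq_square power3_eq_cube power4_eq_xxxx algebra_simps)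
  have "(\<Sum>x\<in>UNIV. (wtrace n (inverse x) + wtrace n (a * x)) ^ 4) =
    (\<Sum>x\<in>UNIV. wtrace n (inverse x) ^ 4) + 4 * (\<Sum>x\<in>UNIV. wtrace n (inverse x) ^ 3 * wtrace n (a * x))
      + 6 * (\<Sum>x\<in>UNIV. wtrace n (inverse x) ^ 2 * wtrace n (a * x) ^ 2)
      + 4 * (\<Sum>x\<in>UNIV. wtrace n (a * x) ^ 3 * wtrace n (inverse x))
      + (\<Sum>x\<in>UNIV. wtrace n (a * x) ^ 4)"
    unfolding binom sum.distrib sum_distrib_left ..
  moreover have "(\<Sum>x\<in>UNIV. wtrace n (inverse x :: 'a) ^ 4) = 0"
    using moment_0_4[of 1] sum_inverse_UNIV[of "\<lambda>x::'a. wtrace n x ^ 4"] by simp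
  moreover have "(\<Sum>x\<in>UNIV. wtrace n (a * x) ^ 3 * wtrace n (inverse x)) = - wtrace n a"
    using moment_3_1[of a 1]
      sum_inverse_UNIV[of "\<lambda>x::'a. wtrace n (a * x) ^ 3 * wtrace n (inverse x)"] by simp
  ultimately show ?thesis
    using moment_0_4[of a] moment_3_1[of 1 a] moment_2_2[of 1 a] by simp
qed

end

section \<open>The number of elements with nonzero trace modulo nine\<close>

lemma abs_trace_add:
  assumes "CARD('a::finite_field) = 3 ^ n"
  shows "abs_trace n (x + y :: 'a) = abs_trace n x + abs_trace n y"
  using freshmans_dream'[of "3 ^ _" _ x y] CHAR_eq_3[OF assms]
  by (simp add: abs_trace_def sum.distrib)

lemma abs_trace_minus: "abs_trace n (- x) = - abs_trace n x"
  by (simp add: abs_trace_def sum_negf)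

lemma power_card_minus_2_eq_inverse:
  assumes "CARD('a::finite_field) > 2"
  shows "(x :: 'a) ^ (CARD('a) - 2) = inverse x"
proof (cases "x = 0")
  case False
  obtain m where m: "CARD('a) = m + 2" using assms le_Suc_ex by (metis add.commute less_imp_le_nat)
  have "x * x ^ (CARD('a) - 2) = x ^ (CARD('a) - 1)" by (simp add: m)
  then have "x * x ^ (CARD('a) - 2) = 1" using power_card_minus_1[OF False] by simp
  then show ?thesis by (metis inverse_unique)
qed (use assms in auto)

text \<open>
  Newton's identity for the third elementary symmetric polynomial, written without division
  so that it can be used modulo 9.
\<close>
lemma sum_cube_newton:
  fixes c :: "nat \<Rightarrow> 'a::comm_ring_1"
  shows "(\<Sum>i<n. c i) ^ 3 = 3 * (\<Sum>i<n. c i) * (\<Sum>i<n. c i ^ 2) - 2 * (\<Sum>i<n. c i ^ 3)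
    + 6 * (\<Sum>k<n. \<Sum>j<k. \<Sum>i<j. c i * c j * c k)"
proof -
  have sq: "(\<Sum>i<m. c i) ^ 2 = (\<Sum>i<m. c i ^ 2) + 2 * (\<Sum>j<m. \<Sum>i<j. c i * c j)" for m
    by (induction m) (simp_all add: power2_sum algebra_simps sum_distrib_left sum_distrib_right)
  show ?thesis
  proof (induction n)
    case (Suc n)
    define p1 p2 p3 e2 e3 where "p1 = (\<Sum>i<n. c i)" and "p2 = (\<Sum>i<n. c i ^ 2)"
      and "p3 = (\<Sum>i<n. c i ^ 3)" and "e2 = (\<Sum>j<n. \<Sum>i<j. c i * c j)"
      and "e3 = (\<Sum>k<n. \<Sum>j<k. \<Sum>i<j. c i * c j * c k)"
    have IH: "p1 ^ 3 = 3 * p1 * p2 - 2 * p3 + 6 * e3" and sq': "p1 ^ 2 = p2 + 2 * e2"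
      using Suc.IH sq[of n] by (simp_all add: p1_def p2_def p3_def e2_def e3_def)
    have "(p1 + c n) ^ 3 = p1 ^ 3 + 3 * c n * p1 ^ 2 + 3 * c n ^ 2 * p1 + c n ^ 3"
      by (simp add: power2_eq_square power3_eq_cube algebra_simps)
    also have "\<dots> = 3 * (p1 + c n) * (p2 + c n ^ 2) - 2 * (p3 + c n ^ 3) + 6 * (e3 + e2 * c n)"
      unfolding IH sq' by (simp add: power2_eq_square power3_eq_cube algebra_simps)
    finally show ?case
      by (simp add: p1_def p2_def p3_def e2_def e3_def sum_distrib_right)
  qed simp
qed

text \<open>
  The third elementary symmetric polynomial of the lifted conjugates of \<open>a\<close>. It lifts \<open>\<tau>\<^sub>Y(a)\<close>; in
  Newton's identity it carries the factor 6, which is 0 in the field but not modulo 9.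
\<close>
definition teich_e3 :: "nat \<Rightarrow> 'a::finite_field \<Rightarrow> 'a witt2" where
  "teich_e3 n a = (\<Sum>k<n. \<Sum>j<k. \<Sum>i<j. teich (a ^ 3 ^ i) * teich (a ^ 3 ^ j) * teich (a ^ 3 ^ k))"

text \<open>
  The bound \<open>3 ^ n - 2\<close> on the exponents amounts to \<open>i, j < n\<close>, and each element of the set comes from
  exactly one ordered pair of indices; likewise for \<open>Y_exps\<close> and triples.
\<close>
lemma X_exps_eq:
  assumes "n \<ge> 2"
  shows "X_exps n = (\<lambda>(j, i). 3 ^ i + 3 ^ j) ` (SIGMA j:{..<n}. {..j})"
proof (intro equalityI subsetI)
  fix r :: nat assume "r \<in> X_exps n"
  then obtain i j where ij: "r = 3 ^ i + 3 ^ j" "r \<le> 3 ^ n - 2" by (auto simp: X_exps_def)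
  moreover have "(1::nat) \<le> 3 ^ i" "(1::nat) \<le> 3 ^ j" by simp_all
  ultimately have "(3::nat) ^ i < 3 ^ n" "(3::nat) ^ j < 3 ^ n" by linarith+
  then have "i < n" "j < n" by simp_all
  then have "(max i j, min i j) \<in> (SIGMA j:{..<n}. {..j})"
    by (auto simp: max_def min_def)
  moreover have "r = (case (max i j, min i j) of (j, i) \<Rightarrow> 3 ^ i + 3 ^ j)"
    using ij(1) by (auto simp: max_def min_def)
  ultimately show "r \<in> (\<lambda>(j, i). 3 ^ i + 3 ^ j) ` (SIGMA j:{..<n}. {..j})"
    by (intro image_eqI)
next
  fix r :: nat assume "r \<in> (\<lambda>(j, i). 3 ^ i + 3 ^ j) ` (SIGMA j:{..<n}. {..j})"
  then obtain i j where ij: "r = 3 ^ i + 3 ^ j" "i < n" "j < n" by auto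
  have "(9::nat) \<le> 3 ^ n" using power_increasing[of 2 n "3::nat"] assms by simp
  then have "r \<le> 3 ^ n - 2"
    using power_3_bounds(2)[OF ij(2)] power_3_bounds(2)[OF ij(3)] ij(1) by linarith
  then show "r \<in> X_exps n" using ij(1) by (auto simp: X_exps_def)
qed

lemma tau_X_exps:
  assumes "n \<ge> 2"
  shows "tau (X_exps n) a = (\<Sum>j<n. \<Sum>i\<le>j. a ^ 3 ^ i * a ^ 3 ^ j)"
proof -
  have "inj_on (\<lambda>(j, i). 3 ^ i + 3 ^ j :: nat) (SIGMA j:{..<n}. {..j})"
    by (auto simp: inj_on_def two_powers_of_3_eq_iff)
  then show ?thesis
    unfolding tau_def X_exps_eq[OF assms]
    by (subst sum.reindex) (auto simp: sum.Sigma power_add intro!: sum.cong)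
qed

lemma two_tau_X_exps:
  assumes "n \<ge> 2"
  shows "2 * tau (X_exps n) a = abs_trace n a ^ 2 + abs_trace n (a ^ 2)"
proof -
  have "2 * (\<Sum>j<m. \<Sum>i\<le>j. c i * c j) = (\<Sum>i<m. c i) ^ 2 + (\<Sum>i<m. c i ^ 2)"
    for c :: "nat \<Rightarrow> 'a" and m
    by (induction m)
      (simp_all add: power2_sum algebra_simps sum_distrib_left lessThan_Suc_atMost[symmetric] power2_eq_square)
  then show ?thesis
    unfolding tau_X_exps[OF assms] abs_trace_def
    by (simp add: mult.commute[of 2] flip: power_mult)
qed

lemma Y_exps_eq:
  "Y_exps n = (\<lambda>(k, j, i). 3 ^ i + 3 ^ j + 3 ^ k) ` (SIGMA k:{..<n}. SIGMA j:{..<k}. {..<j})"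
  (is "_ = ?f ` ?A")
proof (intro equalityI subsetI)
  fix r :: nat assume "r \<in> Y_exps n"
  then obtain i j k where ijk: "i \<noteq> j" "i \<noteq> k" "j \<noteq> k" "r = 3 ^ i + 3 ^ j + 3 ^ k" "r \<le> 3 ^ n - 2"
    by (auto simp: Y_exps_def)
  moreover have "(1::nat) \<le> 3 ^ i" "(1::nat) \<le> 3 ^ j" "(1::nat) \<le> 3 ^ k" by simp_all
  ultimately have "(3::nat) ^ i < 3 ^ n" "(3::nat) ^ j < 3 ^ n" "(3::nat) ^ k < 3 ^ n" by linarith+
  then have lt: "i < n" "j < n" "k < n" by simp_all
  define S where "S = ?f ` ?A"
  have im: "r \<in> S" if "i' < j'" "j' < k'" "k' < n" "r = 3 ^ i' + 3 ^ j' + 3 ^ k'" for i' j' k'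
    using that unfolding S_def by (intro image_eqI[of _ _ "(k', j', i')"]) auto
  consider "i < j \<and> j < k" | "i < k \<and> k < j" | "j < i \<and> i < k" | "j < k \<and> k < i" | "k < i \<and> i < j" | "k < j \<and> j < i"
    using ijk(1-3) by linarith
  then have "r \<in> S"
    using lt ijk(4) im[of i j k] im[of i k j] im[of j i k] im[of j k i] im[of k i j] im[of k j i]
    by cases simp_all
  then show "r \<in> ?f ` ?A" by (simp only: S_def)
next
  fix r :: nat assume "r \<in> ?f ` ?A"
  then obtain i j k where ijk: "r = 3 ^ i + 3 ^ j + 3 ^ k" "i < j" "j < k" "k < n" by auto
  have "(1::nat) \<le> 3 ^ i" by simp
  then have "r \<le> 3 ^ n - 2"
    using ijk(2-)[THEN power_3_bounds(2)] ijk(1) by linarith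
  then have "r \<in> {0..3 ^ n - 2}" by simp
  moreover have "i \<noteq> j" "i \<noteq> k" "j \<noteq> k" using ijk by auto
  ultimately show "r \<in> Y_exps n" unfolding Y_exps_def using ijk(1) by blast
qed

lemma tau_Y_exps: "tau (Y_exps n) a = witt0 (teich_e3 n a)"
proof -
  have "inj_on (\<lambda>(k, j, i). 3 ^ i + 3 ^ j + 3 ^ k :: nat) (SIGMA k:{..<n}. SIGMA j:{..<k}. {..<j})"
    by (auto simp: inj_on_def dest: three_distinct_powers_of_3_eq)
  then show ?thesis
    unfolding tau_def Y_exps_eq teich_e3_def
    by (subst sum.reindex) (auto simp: sum.Sigma power_add intro!: sum.cong)
qed

definition nonzero_count :: "nat \<Rightarrow> 'a::finite_field \<Rightarrow> nat" where
  "nonzero_count n a = card {x. abs_trace n (x ^ (3 ^ n - 2) + a * x) \<noteq> 0}"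

context
  fixes n :: nat
  assumes card: "CARD('a::finite_field) = 3 ^ n" and n: "n \<ge> 3"
begin

lemma wtrace_cube:
  "wtrace n (a :: 'a) ^ 3 = 3 * wtrace n a * wtrace n (a ^ 2) - 2 * wtrace n a + 6 * teich_e3 n a"
proof -
  have "wtrace n (a ^ m) = (\<Sum>i<n. teich (a ^ 3 ^ i) ^ m)" for m
    by (simp add: wtrace_def mult.commute flip: power_mult teich_power)
  then show ?thesis
    using sum_cube_newton[of "\<lambda>i. teich (a ^ 3 ^ i)" n] wtrace_cube_arg[OF card, of a]
    by (simp add: wtrace_def teich_e3_def)
qed

lemma nonzero_count_eq_moments:
  "(of_nat (nonzero_count n a) :: 'a witt2) = 4 * wtrace n a + 3 * wtrace n a ^ 2 + 3 * wtrace n (a ^ 2)"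
proof -
  define t where "t = (\<lambda>x. wtrace n (inverse x) + wtrace n (a * x))"
  have char: "CHAR('a) = 3" using CHAR_eq_3[OF card] .
  have "(3::nat) ^ 1 \<le> 3 ^ n" using n by (intro power_increasing) auto
  then have inv: "x ^ (3 ^ n - 2) = inverse x" for x :: 'a
    using power_card_minus_2_eq_inverse[of x] card by simp
  have t: "witt0 (t x) = abs_trace n (x ^ (3 ^ n - 2) + a * x)" for x
    by (simp add: t_def inv abs_trace_add[OF card])
  have "(of_nat (nonzero_count n a) :: 'a witt2) = (\<Sum>x\<in>UNIV. if witt0 (t x) = 0 then 0 else 1)"
    by (simp add: nonzero_count_def t sum.If_cases Collect_neg_eq)
  also have "\<dots> = (\<Sum>x\<in>UNIV. 2 * t x ^ 4 - t x ^ 2)"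
    using abs_trace_prime_field[OF card] by (intro sum.cong refl) (simp only: t witt2_indicator[OF char])
  also have "\<dots> = 2 * (\<Sum>x\<in>UNIV. t x ^ 4) - (\<Sum>x\<in>UNIV. t x ^ 2)"
    by (simp add: sum_subtractf sum_distrib_left)
  also have "\<dots> = 2 * (- 8 * wtrace n a + 6 * (wtrace n (a ^ 2) - 2 * wtrace n a ^ 2)) + 2 * wtrace n a"
    using sum_wtrace_power4[OF card n, of a] sum_wtrace_power2[OF card n, of a] by (simp add: t_def)
  also have "\<dots> = 4 * wtrace n a + 3 * wtrace n a ^ 2 + 3 * wtrace n (a ^ 2)
      + 9 * (wtrace n (a ^ 2) - 3 * wtrace n a ^ 2 - 2 * wtrace n a)"
    by (simp add: algebra_simps)
  finally show ?thesis using nine_eq_0_witt2[OF char] by simp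
qed

text \<open>
  Newton's identity is used to eliminate the term linear in \<open>T(a)\<close>, the only one in which more
  than the residue of \<open>T(a)\<close> matters: \<open>4 T = 6 T T\<^sub>2 + 12 E - 2 T\<^sup>3\<close>, and \<open>T\<^sup>3\<close> is the cube of an
  integer.
\<close>
lemma nonzero_count_cong:
  fixes a :: 'a and s m :: int
  assumes s: "abs_trace n a = of_int s"
    and m: "of_int m = 2 * abs_trace n a * abs_trace n (a ^ 2) + abs_trace n a ^ 2
      + abs_trace n (a ^ 2) + tau (Y_exps n) a"
  shows "[int (nonzero_count n a) = 3 * m - 2 * s ^ 3] (mod 9)"
proof -
  have char: "CHAR('a) = 3" using CHAR_eq_3[OF card] .
  let ?T = "wtrace n a" and ?T2 = "wtrace n (a ^ 2)" and ?E = "teich_e3 n a"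
  have cube: "?T ^ 3 = of_int s ^ 3"
    using s by (intro witt2_cube[OF char]) simp
  have "of_nat (nonzero_count n a) = 4 * ?T + 3 * ?T ^ 2 + 3 * ?T2"
    by (rule nonzero_count_eq_moments)
  also have "\<dots> = 3 * (2 * ?T * ?T2 + ?T ^ 2 + ?T2 + ?E) - 2 * ?T ^ 3 + 9 * ?E"
    unfolding wtrace_cube by (simp add: algebra_simps)
  also have "\<dots> = 3 * (2 * ?T * ?T2 + ?T ^ 2 + ?T2 + ?E) - 2 * of_int s ^ 3"
    using nine_eq_0_witt2[OF char] cube by simp
  also have "3 * (2 * ?T * ?T2 + ?T ^ 2 + ?T2 + ?E) = 3 * of_int m"
    using m by (intro three_mult_witt2_cong[OF char]) (simp add: tau_Y_exps)
  finally have "(of_int (int (nonzero_count n a) - (3 * m - 2 * s ^ 3)) :: 'a witt2) = 0"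
    by simp
  then show ?thesis
    using of_int_witt2_eq_0_imp_9_dvd[OF char] by (simp only: cong_iff_dvd_diff)
qed

end

section \<open>The Kloosterman sum modulo twenty-seven\<close>

lemma power_prime_field_rep:
  fixes \<zeta> :: "'b::comm_ring_1" and t :: "'a::finite_field"
  assumes card: "CARD('a) = 3 ^ n" and t: "t \<in> {0, 1, 2}"
  shows "\<zeta> ^ prime_field_rep t = of_bool (t = 0) + \<zeta> * of_bool (t = 1) + \<zeta> ^ 2 * of_bool (t = 2)"
proof -
  note two_in_char_3[OF CHAR_eq_3[OF card]]
  moreover have "prime_field_rep t = 0 \<or> prime_field_rep t = 1 \<or> prime_field_rep t = 2"
    using prime_field_rep(1)[OF assms] by auto
  ultimately show ?thesis
    using prime_field_rep(2)[OF assms] by auto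
qed

lemma card_trace_eq_symmetric:
  fixes a :: "'a::finite_field"
  assumes card: "CARD('a) = 3 ^ n" and n: "n \<ge> 1"
  shows "card {x. abs_trace n (x ^ (3 ^ n - 2) + a * x) = 2} =
    card {x. abs_trace n (x ^ (3 ^ n - 2) + a * x) = 1}"
proof -
  define t where "t = (\<lambda>x. abs_trace n (x ^ (3 ^ n - 2) + a * x))"
  have "(3::nat) ^ 1 \<le> 3 ^ n" using n by (intro power_increasing) auto
  then have "x ^ (3 ^ n - 2) = inverse x" for x :: 'a
    using power_card_minus_2_eq_inverse[of x] card by simp
  then have neg: "t (- x) = - t x" for x
    by (simp add: t_def flip: abs_trace_minus)
  note two = two_in_char_3(1)[OF CHAR_eq_3[OF card]]
  have "bij_betw uminus {x. t x = 2} {x. t x = 1}"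
    by (rule bij_betw_byWitness[of _ uminus]) (auto simp: neg two)
  then show ?thesis unfolding t_def by (rule bij_betw_same_card)
qed

text \<open>
  With \<open>N\<^sub>c\<close> the number of \<open>x\<close> for which the trace is \<open>c\<close>, the sum is \<open>N\<^sub>0 + \<zeta> N\<^sub>1 + \<zeta>\<^sup>2 N\<^sub>1 = N\<^sub>0 - N\<^sub>1\<close>, while
  \<open>N\<^sub>0 + 2 N\<^sub>1 = 3 ^ n\<close> is divisible by 27. Hence \<open>K = 3 ^ n - 3 N\<^sub>1\<close> depends modulo 27 only on \<open>N\<^sub>1\<close>
  modulo 9.
\<close>
lemma kloosterman_cong:
  fixes a :: "'a::finite_field"
  assumes card: "CARD('a) = 3 ^ n" and n: "n \<ge> 3"
  obtains K :: int where "\<And>\<zeta>. primitive_cube_root \<zeta> \<Longrightarrow> kloosterman n \<zeta> a = of_int K"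
    and "\<And>s m. abs_trace n a = of_int s \<Longrightarrow>
      of_int m = 2 * abs_trace n a * abs_trace n (a ^ 2) + abs_trace n a ^ 2
        + abs_trace n (a ^ 2) + tau (Y_exps n) a \<Longrightarrow> [K = 9 * m + 3 * s ^ 3] (mod 27)"
proof -
  define t where "t = (\<lambda>x. abs_trace n (x ^ (3 ^ n - 2) + a * x))"
  define N where "N = (\<lambda>c. card {x. t x = c})"
  have N12: "N 2 = N 1"
    using card_trace_eq_symmetric[OF card, of a] n by (simp add: N_def t_def)
  have t: "t x \<in> {0, 1, 2}" for x
    unfolding t_def by (rule abs_trace_prime_field[OF card])
  note two = two_in_char_3(2,3)[OF CHAR_eq_3[OF card]]
  have disj: "{x. t x = 1} \<inter> {x. t x = 2} = {}" using two(2) by auto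
  have "{x. t x \<noteq> 0} = {x. t x = 1} \<union> {x. t x = 2}" using t two(1) by auto
  then have M: "nonzero_count n a = 2 * N 1"
    using N12 card_Un_disjoint[OF _ _ disj]
    by (simp add: nonzero_count_def N_def t_def)
  have "UNIV = {x. t x = 0} \<union> {x. t x \<noteq> 0}" by auto
  then have total: "3 ^ n = N 0 + 2 * N 1"
    using card_Un_disjoint[of "{x. t x = 0}" "{x. t x \<noteq> 0}"] M card
    by (auto simp: nonzero_count_def N_def t_def)
  define K where "K = int (N 0) - int (N 1)"
  show ?thesis
  proof (rule that)
    fix \<zeta> :: complex assume \<zeta>: "primitive_cube_root \<zeta>"
    then have "\<zeta> ^ 3 = 1" "\<zeta> ^ 1 \<noteq> 1" unfolding primitive_cube_root_def by auto
    then have "(\<zeta> - 1) * (\<zeta> ^ 2 + \<zeta> + 1) = 0" "\<zeta> - 1 \<noteq> 0"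
      by (simp_all add: algebra_simps power2_eq_square power3_eq_cube)
    then have "\<zeta> ^ 2 + \<zeta> + 1 = 0" by simp
    then have root: "\<zeta> ^ 2 = - 1 - \<zeta>" by algebra
    have "kloosterman n \<zeta> a =
        (\<Sum>x\<in>UNIV. of_bool (t x = 0) + \<zeta> * of_bool (t x = 1) + \<zeta> ^ 2 * of_bool (t x = 2))"
      unfolding kloosterman_def using power_prime_field_rep[OF card t, of \<zeta>]
      by (intro sum.cong refl) (simp add: t_def)
    also have "\<dots> = of_nat (N 0) + \<zeta> * of_nat (N 1) + \<zeta> ^ 2 * of_nat (N 2)"
      by (simp add: sum.distrib N_def flip: sum_distrib_left)
    also have "\<dots> = of_int K"
      unfolding N12 root K_def by (simp add: algebra_simps)
    finally show "kloosterman n \<zeta> a = of_int K" .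
  next
    fix s m :: int
    assume "abs_trace n a = of_int s"
      "of_int m = 2 * abs_trace n a * abs_trace n (a ^ 2) + abs_trace n a ^ 2
        + abs_trace n (a ^ 2) + tau (Y_exps n) a"
    then have "[2 * int (N 1) = 3 * m - 2 * s ^ 3] (mod 9)"
      using nonzero_count_cong[OF card n, of a s m] by (simp add: M)
    then obtain j where j: "3 * m - 2 * s ^ 3 = 2 * int (N 1) + 9 * j"
      by (auto simp: cong_iff_lin)
    have "(27::nat) dvd 3 ^ n" using le_imp_power_dvd[of 3 n "3::nat"] n by simp
    then obtain q where "(3::nat) ^ n = 27 * q" by blast
    then have "27 * int q = int (N 0) + 2 * int (N 1)" using total by linarith
    then show "[K = 9 * m + 3 * s ^ 3] (mod 27)"
      using j unfolding K_def cong_iff_dvd_diff by presburger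
  qed
qed

theorem theorem3:
  fixes n :: nat and a :: "'a::finite_field"
  assumes "n \<ge> 3" and "CARD('a) = 3 ^ n"
  shows "\<exists>K::int. (\<forall>\<zeta>. primitive_cube_root \<zeta> \<longrightarrow> kloosterman n \<zeta> a = of_int K) \<and>
    (abs_trace n a = 0 \<and> tau (Y_exps n) a + 2 * tau (X_exps n) a = 0 \<longrightarrow> [K = 0] (mod 27)) \<and>
    (abs_trace n a = 1 \<and> tau (Y_exps n) a = 2 \<longrightarrow> [K = 3] (mod 27)) \<and>
    (abs_trace n a = 2 \<and> tau (Y_exps n) a + tau (X_exps n) a = 2 \<longrightarrow> [K = 6] (mod 27)) \<and>
    (abs_trace n a = 0 \<and> tau (Y_exps n) a + 2 * tau (X_exps n) a = 1 \<longrightarrow> [K = 9] (mod 27)) \<and>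
    (abs_trace n a = 1 \<and> tau (Y_exps n) a = 0 \<longrightarrow> [K = 12] (mod 27)) \<and>
    (abs_trace n a = 2 \<and> tau (Y_exps n) a + tau (X_exps n) a = 0 \<longrightarrow> [K = 15] (mod 27)) \<and>
    (abs_trace n a = 0 \<and> tau (Y_exps n) a + 2 * tau (X_exps n) a = 2 \<longrightarrow> [K = 18] (mod 27)) \<and>
    (abs_trace n a = 1 \<and> tau (Y_exps n) a = 1 \<longrightarrow> [K = 21] (mod 27)) \<and>
    (abs_trace n a = 2 \<and> tau (Y_exps n) a + tau (X_exps n) a = 1 \<longrightarrow> [K = 24] (mod 27))"
proof -
  have three: "(3 :: 'a) = 0"
    by (rule three_eq_0_char_3[OF CHAR_eq_3[OF assms(2)]])
  let ?Tr = "abs_trace n a" and ?Tr2 = "abs_trace n (a ^ 2)"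
    and ?X = "tau (X_exps n) a" and ?Y = "tau (Y_exps n) a"
  obtain K :: int where K: "\<And>\<zeta>. primitive_cube_root \<zeta> \<Longrightarrow> kloosterman n \<zeta> a = of_int K"
    and cong: "\<And>s m. ?Tr = of_int s \<Longrightarrow>
      of_int m = 2 * ?Tr * ?Tr2 + ?Tr ^ 2 + ?Tr2 + ?Y \<Longrightarrow> [K = 9 * m + 3 * s ^ 3] (mod 27)"
    using kloosterman_cong[OF assms(2,1), of a] by metis
  have Tr2: "?Tr2 = 2 * ?X - ?Tr ^ 2"
    using two_tau_X_exps[of n a] assms(1) by simp
  have Tr_0: "[K = 9 * c] (mod 27)" if "?Tr = 0" "?Y + 2 * ?X = of_int c" for c
    using cong[of 0 c] that by (simp add: Tr2 add.commute)
  have Tr_1: "[K = 9 * c + 12] (mod 27)" if "?Tr = 1" "?Y = of_int c" for c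
  proof -
    have "2 * ?Tr * ?Tr2 + ?Tr ^ 2 + ?Tr2 + ?Y = of_int (c + 1) + 3 * ?Tr2"
      using that by simp
    then show ?thesis using cong[of 1 "c + 1"] that by (simp add: three add.commute)
  qed
  have Tr_2: "[K = 9 * c + 15] (mod 27)" if "?Tr = 2" "?Y + ?X = of_int c" for c
  proof -
    have "2 * ?Tr * ?Tr2 + ?Tr ^ 2 + ?Tr2 + ?Y = (?Y + ?X) + 2 + 3 * (3 * ?X - 6)"
      unfolding Tr2 that(1) by (simp add: algebra_simps)
    moreover have "?Tr = of_int (- 1)" using that(1) three by (simp add: eq_neg_iff_add_eq_0)
    ultimately show ?thesis using cong[of "- 1" "c + 2"] that(2) by (simp add: three add.commute)
  qed
  have reduce: "[K = 30] (mod 27) \<Longrightarrow> [K = 3] (mod 27)" "[K = 33] (mod 27) \<Longrightarrow> [K = 6] (mod 27)"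
    by (simp_all add: cong_def)
  show ?thesis
    using K Tr_0[of 0] Tr_0[of 1] Tr_0[of 2] Tr_1[of 0] Tr_1[of 1] Tr_1[of 2]
      Tr_2[of 0] Tr_2[of 1] Tr_2[of 2] reduce
    by (intro exI[of _ K]) simp
qed

end
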